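(* Let $G$ be a finitely generated large group. Then there is a normal subgroup $N\unlhd G$ such that the quotient $G/N$ is a linear group that is not virtually solvable.
   Context: A group $G$ is large if it has a finite-index subgroup that admits a surjective homomorphism onto the free group $F_2$ of rank $2$. A group is linear if it is isomorphic to a subgroup of $GL_m(K)$ for some $m\ge 1$ and some field $K$. A group is virtually solvable if it has a solvable subgroup of finite index. *)

theory Defs
  imports "HOL-Algebra.Algebra" "HOL-Library.Nat_Bijection"
begin

section \<open>Free groups of finite rank\<close>

text \<open>The letter \<open>(i, True)\<close> stands for the generator \<open>x\<^sub>i\<close>, and \<open>(i, False)\<close> for its inverse.
  Elements of the free group of rank \<open>n\<close> are the reduced words in the letters with \<open>i < n\<close>,
  multiplied by concatenation followed by free reduction.\<close>

definition letter_inv :: "nat \<times> bool \<Rightarrow> nat \<times> bool"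
  where "letter_inv a = (fst a, \<not> snd a)"

definition reduced :: "(nat \<times> bool) list \<Rightarrow> bool"
  where "reduced w \<longleftrightarrow> successively (\<lambda>a b. b \<noteq> letter_inv a) w"

fun push_letter :: "nat \<times> bool \<Rightarrow> (nat \<times> bool) list \<Rightarrow> (nat \<times> bool) list"
  where
    "push_letter a [] = [a]"
  | "push_letter a (b # w) = (if b = letter_inv a then w else a # b # w)"

definition free_group :: "nat \<Rightarrow> (nat \<times> bool) list monoid"
  where "free_group n =
    \<lparr>carrier = {w. reduced w \<and> fst ` set w \<subseteq> {..<n}}, monoid.mult = foldr push_letter, one = []\<rparr>"

lemma letter_inv_simps [simp]:
  "letter_inv (letter_inv a) = a" "fst (letter_inv a) = fst a"
  by (simp_all add: letter_inv_def)

lemma reduced_Cons: "reduced (a # w) \<longleftrightarrow> reduced w \<and> (w = [] \<or> hd w \<noteq> letter_inv a)"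
  by (cases w) (auto simp: reduced_def)

lemma reduced_push: "reduced w \<Longrightarrow> reduced (push_letter a w)"
  by (cases w) (auto simp: reduced_def successively_Cons)

lemma reduced_foldr: "reduced w \<Longrightarrow> reduced (foldr push_letter u w)"
  by (induction u) (auto intro: reduced_push)

lemma push_push_inv: "reduced w \<Longrightarrow> push_letter a (push_letter (letter_inv a) w) = w"
  by (cases w; cases "tl w") (auto simp: reduced_Cons)

lemma foldr_push:
  assumes "reduced w"
  shows "foldr push_letter (push_letter a v) w = push_letter a (foldr push_letter v w)"
  using assms by (cases v) (auto simp: push_push_inv reduced_foldr)

lemma foldr_assoc:
  assumes "reduced w"
  shows "foldr push_letter (foldr push_letter u v) w = foldr push_letter u (foldr push_letter v w)"
  using assms by (induction u) (auto simp: foldr_push)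

lemma letters_push: "fst ` set (push_letter a w) \<subseteq> insert (fst a) (fst ` set w)"
  by (cases w) auto

lemma letters_foldr: "fst ` set (foldr push_letter u w) \<subseteq> fst ` set u \<union> fst ` set w"
proof (induction u)
  case (Cons a u)
  have "fst ` set (foldr push_letter (a # u) w) \<subseteq> insert (fst a) (fst ` set (foldr push_letter u w))"
    using letters_push by simp
  with Cons show ?case by (simp only: list.set image_insert) blast
qed auto

lemma foldr_push_Nil: "reduced u \<Longrightarrow> foldr push_letter u [] = u"
proof (induction u)
  case (Cons a u)
  then show ?case by (cases u) (auto simp: reduced_Cons)
qed auto

lemma foldr_push_inverse: "foldr push_letter (rev (map letter_inv u)) u = []"
  by (induction u) auto

lemma reduced_inverse: "reduced u \<Longrightarrow> reduced (rev (map letter_inv u))"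
  unfolding reduced_def successively_rev successively_map
  by (erule successively_mono) (auto simp: letter_inv_def)

lemma group_free_group: "group (free_group n)"
proof (rule groupI)
  fix u v assume "u \<in> carrier (free_group n)" "v \<in> carrier (free_group n)"
  then show "u \<otimes>\<^bsub>free_group n\<^esub> v \<in> carrier (free_group n)"
    using order_trans[OF letters_foldr[of u v]] by (simp add: free_group_def reduced_foldr)
next
  fix u assume u: "u \<in> carrier (free_group n)"
  then have "rev (map letter_inv u) \<in> carrier (free_group n)"
    by (auto simp: free_group_def reduced_inverse)
  then show "\<exists>v\<in>carrier (free_group n). v \<otimes>\<^bsub>free_group n\<^esub> u = \<one>\<^bsub>free_group n\<^esub>"
    by (rule bexI[rotated]) (simp add: free_group_def foldr_push_inverse)
qed (auto simp: free_group_def foldr_assoc reduced_def)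


section \<open>General linear groups\<close>

definition matrix_monoid :: "nat \<Rightarrow> ('k, 'r) ring_scheme \<Rightarrow> (nat \<times> nat \<Rightarrow> 'k) monoid"
  where "matrix_monoid m K =
    \<lparr>carrier = {..<m} \<times> {..<m} \<rightarrow>\<^sub>E carrier K,
     monoid.mult = (\<lambda>A B. \<lambda>(i, j) \<in> {..<m} \<times> {..<m}. \<Oplus>\<^bsub>K\<^esub>k\<in>{..<m}. A (i, k) \<otimes>\<^bsub>K\<^esub> B (k, j)),
     one = (\<lambda>(i, j) \<in> {..<m} \<times> {..<m}. if i = j then \<one>\<^bsub>K\<^esub> else \<zero>\<^bsub>K\<^esub>)\<rparr>"

definition GL :: "nat \<Rightarrow> ('k, 'r) ring_scheme \<Rightarrow> (nat \<times> nat \<Rightarrow> 'k) monoid"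
  where "GL m K = units_of (matrix_monoid m K)"

lemma (in abelian_monoid) finsum_swap:
  assumes "finite A" "finite B" "\<And>i j. i \<in> A \<Longrightarrow> j \<in> B \<Longrightarrow> f i j \<in> carrier G"
  shows "(\<Oplus>i\<in>A. \<Oplus>j\<in>B. f i j) = (\<Oplus>j\<in>B. \<Oplus>i\<in>A. f i j)"
  using assms(1,3)
proof (induction A rule: finite_induct)
  case empty
  then show ?case by (simp add: finsum_zero)
next
  case (insert x A)
  have "(\<Oplus>i\<in>insert x A. \<Oplus>j\<in>B. f i j) = (\<Oplus>j\<in>B. f x j) \<oplus> (\<Oplus>i\<in>A. \<Oplus>j\<in>B. f i j)"
    using insert by (intro finsum_insert) (auto intro!: finsum_closed)
  also have "\<dots> = (\<Oplus>j\<in>B. f x j) \<oplus> (\<Oplus>j\<in>B. \<Oplus>i\<in>A. f i j)"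
    using insert by simp
  also have "\<dots> = (\<Oplus>j\<in>B. f x j \<oplus> (\<Oplus>i\<in>A. f i j))"
    using insert by (intro finsum_addf[symmetric]) (auto intro!: finsum_closed)
  also have "\<dots> = (\<Oplus>j\<in>B. \<Oplus>i\<in>insert x A. f i j)"
    using insert by (intro finsum_cong') (auto intro!: finsum_closed finsum_insert[symmetric])
  finally show ?case .
qed

lemma (in cring) finsum_delta:
  assumes "finite A" "i \<in> A" "\<And>k. k \<in> A \<Longrightarrow> f k \<in> carrier R"
  shows "(\<Oplus>k\<in>A. (if i = k then \<one> else \<zero>) \<otimes> f k) = f i"
    and "(\<Oplus>k\<in>A. f k \<otimes> (if k = i then \<one> else \<zero>)) = f i"
proof -
  have "(\<Oplus>k\<in>A. (if i = k then \<one> else \<zero>) \<otimes> f k) = (\<Oplus>k\<in>A. if i = k then f k else \<zero>)"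
    using assms by (intro finsum_cong') auto
  then show "(\<Oplus>k\<in>A. (if i = k then \<one> else \<zero>) \<otimes> f k) = f i"
    using finsum_singleton[of i A f] assms by simp
  have "(\<Oplus>k\<in>A. f k \<otimes> (if k = i then \<one> else \<zero>)) = (\<Oplus>k\<in>A. if i = k then f k else \<zero>)"
    using assms by (intro finsum_cong') auto
  then show "(\<Oplus>k\<in>A. f k \<otimes> (if k = i then \<one> else \<zero>)) = f i"
    using finsum_singleton[of i A f] assms by simp
qed

lemma (in cring) monoid_matrix_monoid: "monoid (matrix_monoid m R)"
proof (rule monoidI)
  let ?M = "matrix_monoid m R" and ?I = "{..<m} \<times> {..<m}"
  have entry: "A (i, j) \<in> carrier R" if "A \<in> carrier ?M" "i < m" "j < m" for A i j
    using that by (auto simp: matrix_monoid_def)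
  show closed: "A \<otimes>\<^bsub>?M\<^esub> B \<in> carrier ?M" if "A \<in> carrier ?M" "B \<in> carrier ?M" for A B
    using entry[OF that(1)] entry[OF that(2)]
    by (auto simp: matrix_monoid_def intro!: finsum_closed)
  show "\<one>\<^bsub>?M\<^esub> \<in> carrier ?M"
    by (auto simp: matrix_monoid_def)
  have eq: "A = B" if "A \<in> carrier ?M" "B \<in> carrier ?M"
    "\<And>i j. i < m \<Longrightarrow> j < m \<Longrightarrow> A (i, j) = B (i, j)" for A B
    using that(1,2)[unfolded matrix_monoid_def, simplified] that(3) by (intro PiE_ext) auto
  have mult: "(A \<otimes>\<^bsub>?M\<^esub> B) (i, j) = (\<Oplus>k\<in>{..<m}. A (i, k) \<otimes> B (k, j))" if "i < m" "j < m" for A B i j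
    using that by (simp add: matrix_monoid_def)
  have one: "\<one>\<^bsub>?M\<^esub> (i, j) = (if i = j then \<one> else \<zero>)" if "i < m" "j < m" for i j
    using that by (simp add: matrix_monoid_def)
  show "\<one>\<^bsub>?M\<^esub> \<otimes>\<^bsub>?M\<^esub> A = A" if A: "A \<in> carrier ?M" for A
  proof (rule eq[OF closed[OF \<open>\<one>\<^bsub>?M\<^esub> \<in> carrier ?M\<close> A] A])
    fix i j assume ij: "i < m" "j < m"
    have "(\<one>\<^bsub>?M\<^esub> \<otimes>\<^bsub>?M\<^esub> A) (i, j) = (\<Oplus>k\<in>{..<m}. (if i = k then \<one> else \<zero>) \<otimes> A (k, j))"
      using ij entry[OF A] unfolding mult[OF ij] by (intro finsum_cong') (auto simp: one)
    then show "(\<one>\<^bsub>?M\<^esub> \<otimes>\<^bsub>?M\<^esub> A) (i, j) = A (i, j)"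
      using finsum_delta(1)[of "{..<m}" i "\<lambda>k. A (k, j)"] ij entry[OF A] by simp
  qed
  show "A \<otimes>\<^bsub>?M\<^esub> \<one>\<^bsub>?M\<^esub> = A" if A: "A \<in> carrier ?M" for A
  proof (rule eq[OF closed[OF A \<open>\<one>\<^bsub>?M\<^esub> \<in> carrier ?M\<close>] A])
    fix i j assume ij: "i < m" "j < m"
    have "(A \<otimes>\<^bsub>?M\<^esub> \<one>\<^bsub>?M\<^esub>) (i, j) = (\<Oplus>k\<in>{..<m}. A (i, k) \<otimes> (if k = j then \<one> else \<zero>))"
      using ij entry[OF A] unfolding mult[OF ij] by (intro finsum_cong') (auto simp: one)
    then show "(A \<otimes>\<^bsub>?M\<^esub> \<one>\<^bsub>?M\<^esub>) (i, j) = A (i, j)"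
      using finsum_delta(2)[of "{..<m}" j "\<lambda>k. A (i, k)"] ij entry[OF A] by simp
  qed
  show "A \<otimes>\<^bsub>?M\<^esub> B \<otimes>\<^bsub>?M\<^esub> C = A \<otimes>\<^bsub>?M\<^esub> (B \<otimes>\<^bsub>?M\<^esub> C)"
    if A: "A \<in> carrier ?M" and B: "B \<in> carrier ?M" and C: "C \<in> carrier ?M" for A B C
  proof (rule eq[OF closed[OF closed[OF A B] C] closed[OF A closed[OF B C]]])
    fix i j assume ij: "i < m" "j < m"
    note [simp] = entry[OF A] entry[OF B] entry[OF C] ij
    have "(A \<otimes>\<^bsub>?M\<^esub> B \<otimes>\<^bsub>?M\<^esub> C) (i, j)
        = (\<Oplus>k\<in>{..<m}. (\<Oplus>l\<in>{..<m}. A (i, l) \<otimes> B (l, k)) \<otimes> C (k, j))"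
      unfolding mult[OF ij] by (intro finsum_cong') (auto simp: mult intro!: finsum_closed)
    also have "\<dots> = (\<Oplus>k\<in>{..<m}. \<Oplus>l\<in>{..<m}. A (i, l) \<otimes> (B (l, k) \<otimes> C (k, j)))"
      by (intro finsum_cong')
         (auto simp: finsum_ldistr m_assoc intro!: finsum_cong' finsum_closed)
    also have "\<dots> = (\<Oplus>l\<in>{..<m}. \<Oplus>k\<in>{..<m}. A (i, l) \<otimes> (B (l, k) \<otimes> C (k, j)))"
      by (rule finsum_swap) auto
    also have "\<dots> = (\<Oplus>l\<in>{..<m}. A (i, l) \<otimes> (\<Oplus>k\<in>{..<m}. B (l, k) \<otimes> C (k, j)))"
      by (intro finsum_cong') (auto simp: finsum_rdistr intro!: finsum_closed)
    also have "\<dots> = (A \<otimes>\<^bsub>?M\<^esub> (B \<otimes>\<^bsub>?M\<^esub> C)) (i, j)"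
      unfolding mult[OF ij] by (intro finsum_cong') (auto simp: mult intro!: finsum_closed)
    finally show "(A \<otimes>\<^bsub>?M\<^esub> B \<otimes>\<^bsub>?M\<^esub> C) (i, j) = (A \<otimes>\<^bsub>?M\<^esub> (B \<otimes>\<^bsub>?M\<^esub> C)) (i, j)" .
  qed
qed

lemma (in cring) group_GL: "group (GL m R)"
  unfolding GL_def by (rule monoid.units_group[OF monoid_matrix_monoid])


section \<open>Linear, large, and virtually solvable groups\<close>

definition finite_index :: "'a set \<Rightarrow> ('a, 'b) monoid_scheme \<Rightarrow> bool"
  where "finite_index H G \<longleftrightarrow> subgroup H G \<and> finite (rcosets\<^bsub>G\<^esub> H)"

definition finitely_generated :: "('a, 'b) monoid_scheme \<Rightarrow> bool"
  where "finitely_generated G \<longleftrightarrow>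
    (\<exists>S. finite S \<and> S \<subseteq> carrier G \<and> generate G S = carrier G)"

definition large_group :: "('a, 'b) monoid_scheme \<Rightarrow> bool"
  where "large_group G \<longleftrightarrow>
    (\<exists>H. finite_index H G \<and> (\<exists>f. f \<in> epi (G\<lparr>carrier := H\<rparr>) (free_group 2)))"

definition virtually_solvable :: "('a, 'b) monoid_scheme \<Rightarrow> bool"
  where "virtually_solvable G \<longleftrightarrow>
    (\<exists>H. finite_index H G \<and> solvable (G\<lparr>carrier := H\<rparr>))"

text \<open>HOL cannot quantify over the type carrying the field inside a definition.  Requiring the
  carrier of \<open>K\<close> to be a subset of the type \<^typ>\<open>('a \<times> nat) list\<close> loses no generality: if \<open>G\<close> embeds
  in \<open>GL m K\<close> for any field \<open>K\<close>, the entries of its image generate a subfield that injects into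
  that type.  Lemma \<open>linear_group_over_any_field\<close> below proves this.\<close>

definition linear_group :: "('a, 'b) monoid_scheme \<Rightarrow> bool"
  where "linear_group G \<longleftrightarrow>
    (\<exists>(K :: ('a \<times> nat) list ring) m H.
      field K \<and> 1 \<le> m \<and> subgroup H (GL m K) \<and> G \<cong> (GL m K)\<lparr>carrier := H\<rparr>)"


text \<open>Sequences of field operations in reverse Polish notation, acting on a stack; \<open>e a n\<close> are
  the initially available elements.\<close>

fun field_op :: "('k, 'r) ring_scheme \<Rightarrow> ('a \<Rightarrow> nat \<Rightarrow> 'k) \<Rightarrow> 'a \<times> nat \<Rightarrow> 'k list \<Rightarrow> 'k list"
  where
    "field_op K e (a, Suc (Suc (Suc (Suc (Suc n))))) st = e a n # st"
  | "field_op K e (a, 0) st = \<one>\<^bsub>K\<^esub> # st"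
  | "field_op K e (a, Suc 0) (x # st) = (\<ominus>\<^bsub>K\<^esub> x) # st"
  | "field_op K e (a, Suc (Suc 0)) (x # st) = (inv\<^bsub>K\<^esub> x) # st"
  | "field_op K e (a, Suc (Suc (Suc 0))) (x # y # st) = (x \<oplus>\<^bsub>K\<^esub> y) # st"
  | "field_op K e (a, Suc (Suc (Suc (Suc 0)))) (x # y # st) = (x \<otimes>\<^bsub>K\<^esub> y) # st"
  | "field_op K e _ st = st"

lemma generate_field_subset_range:
  fixes e :: "'a \<Rightarrow> nat \<Rightarrow> 'k"
  assumes "S \<subseteq> range (\<lambda>(a, n). e a n)" "x \<in> generate_field K S"
  shows "x \<in> range (\<lambda>w. hd (foldr (field_op K e) w []))"
proof -
  let ?ev = "foldr (field_op K e)"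
  fix a :: 'a
  have "\<exists>w. \<forall>st. ?ev w st = x # st"
    using assms(2)
  proof induction
    case one
    show ?case by (rule exI[of _ "[(a, 0)]"]) simp
  next
    case (incl h)
    then obtain b n where "h = e b n" using assms(1) by auto
    then show ?case by (intro exI[of _ "[(b, Suc (Suc (Suc (Suc (Suc n)))))]"]) simp
  next
    case (a_inv h)
    then obtain w where "\<forall>st. ?ev w st = h # st" by blast
    then show ?case by (intro exI[of _ "(a, Suc 0) # w"]) simp
  next
    case (m_inv h)
    then obtain w where "\<forall>st. ?ev w st = h # st" by blast
    then show ?case by (intro exI[of _ "(a, Suc (Suc 0)) # w"]) simp
  next
    case (eng_add x y)
    then obtain u v where "\<forall>st. ?ev u st = x # st" "\<forall>st. ?ev v st = y # st" by blast
    then show ?case by (intro exI[of _ "(a, Suc (Suc (Suc 0))) # u @ v"]) simp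
  next
    case (eng_mult x y)
    then obtain u v where "\<forall>st. ?ev u st = x # st" "\<forall>st. ?ev v st = y # st" by blast
    then show ?case by (intro exI[of _ "(a, Suc (Suc (Suc (Suc 0)))) # u @ v"]) simp
  qed
  then obtain w where "?ev w [] = [x]" by blast
  then show ?thesis by (metis list.sel(1) rangeI)
qed

lemma linear_group_over_any_field:
  fixes G :: "('a, 'b) monoid_scheme" and K :: "('k, 'r) ring_scheme"
  assumes G: "group G" and K: "field K" and m: "1 \<le> m"
    and H: "subgroup H (GL m K)" and iso: "G \<cong> (GL m K)\<lparr>carrier := H\<rparr>"
  shows "linear_group G"
proof -
  interpret G: group G by fact
  interpret K: field K by fact
  let ?I = "{..<m} \<times> {..<m}"
  obtain h where h: "h \<in> iso G ((GL m K)\<lparr>carrier := H\<rparr>)"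
    using iso by (auto simp: is_iso_def)
  have h_mult: "h (x \<otimes>\<^bsub>G\<^esub> y) = h x \<otimes>\<^bsub>matrix_monoid m K\<^esub> h y"
    if "x \<in> carrier G" "y \<in> carrier G" for x y
    using h that by (auto simp: iso_def hom_def GL_def units_of_def)
  have inj_h: "inj_on h (carrier G)"
    using h by (auto simp: iso_def bij_betw_def)
  have h_in: "h x \<in> ?I \<rightarrow>\<^sub>E carrier K" if "x \<in> carrier G" for x
  proof -
    have "h x \<in> carrier (GL m K)"
      using h that subgroup.subset[OF H] by (auto simp: iso_def hom_def)
    then show ?thesis
      by (simp add: GL_def units_of_def Units_def matrix_monoid_def)
  qed
  have h_one: "h \<one>\<^bsub>G\<^esub> = \<one>\<^bsub>matrix_monoid m K\<^esub>"
  proof -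
    interpret GL: group "GL m K" by (rule K.group_GL)
    interpret h: group_hom G "(GL m K)\<lparr>carrier := H\<rparr>" h
      using h GL.subgroup_imp_group[OF H]
      by (simp add: group_hom_def group_hom_axioms_def iso_def G)
    show ?thesis using h.hom_one by (simp add: GL_def units_of_def)
  qed

  define e where "e = (\<lambda>x n. h x (prod_decode n))"
  define S where "S = (\<lambda>(x, p). h x p) ` (carrier G \<times> ?I)"
  define F where "F = generate_field K S"
  have S_K: "S \<subseteq> carrier K" using h_in by (auto simp: S_def)
  have S_e: "S \<subseteq> range (\<lambda>(x, n). e x n)"
  proof
    fix s assume "s \<in> S"
    then obtain x p where "s = h x p" by (auto simp: S_def)
    then have "s = (\<lambda>(x, n). e x n) (x, prod_encode p)" by (simp add: e_def)
    then show "s \<in> range (\<lambda>(x, n). e x n)" by blast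
  qed
  have field_F: "field (K\<lparr>carrier := F\<rparr>)"
    unfolding F_def by (rule K.generate_field_is_field[OF S_K])
  then interpret F: field "K\<lparr>carrier := F\<rparr>" .
  have F_K: "F \<subseteq> carrier K"
    unfolding F_def by (rule K.generate_field_incl[OF S_K])
  have h_F: "h x (i, j) \<in> F" if "x \<in> carrier G" "i < m" "j < m" for x i j
    unfolding F_def using that by (intro generate_field.incl) (force simp: S_def)

  define \<iota> :: "'k \<Rightarrow> ('a \<times> nat) list"
    where "\<iota> = inv_into UNIV (\<lambda>w. hd (foldr (field_op K e) w []))"
  have inj: "inj_on \<iota> F"
    unfolding \<iota>_def F_def
    using generate_field_subset_range[OF S_e] by (intro inj_on_inv_into) blast
  define L where "L = image_ring \<iota> (K\<lparr>carrier := F\<rparr>)"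
  have "field L"
    unfolding L_def using inj by (intro F.inj_imp_image_ring_is_field) simp
  then interpret L: field L .
  have \<iota>: "\<iota> \<in> ring_hom (K\<lparr>carrier := F\<rparr>) L"
    using inj_imp_image_ring_iso[of \<iota> "K\<lparr>carrier := F\<rparr>"] inj
    by (simp add: L_def ring_iso_def)
  interpret \<iota>: ring_hom_cring "K\<lparr>carrier := F\<rparr>" L \<iota>
    using \<iota> F.is_cring L.is_cring by (simp add: ring_hom_cring_def ring_hom_cring_axioms_def)
  interpret inc: ring_hom_cring "K\<lparr>carrier := F\<rparr>" K "\<lambda>x. x"
    using F_K F.is_cring K.is_cring
    by (auto simp: ring_hom_cring_def ring_hom_cring_axioms_def ring_hom_def)
  have \<iota>_mult: "\<iota> (x \<otimes>\<^bsub>K\<^esub> y) = \<iota> x \<otimes>\<^bsub>L\<^esub> \<iota> y" if "x \<in> F" "y \<in> F" for x y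
    using \<iota>.hom_mult[of x y] that by simp
  have \<iota>_L: "\<iota> x \<in> carrier L" if "x \<in> F" for x
    using \<iota>.hom_closed[of x] that by simp
  have F_mult: "x \<otimes>\<^bsub>K\<^esub> y \<in> F" if "x \<in> F" "y \<in> F" for x y
    using F.m_closed[of x y] that by simp
  have \<iota>_sum: "\<iota> (\<Oplus>\<^bsub>K\<^esub>k\<in>A. f k) = (\<Oplus>\<^bsub>L\<^esub>k\<in>A. \<iota> (f k))" if "f \<in> A \<rightarrow> F" for A :: "nat set" and f
    using inc.hom_finsum[of f A] \<iota>.hom_finsum[of f A] that by (simp add: comp_def)

  let ?M = "matrix_monoid m L"
  define \<psi> where "\<psi> = (\<lambda>x. \<lambda>p\<in>?I. \<iota> (h x p))"
  have \<psi>_in: "\<psi> x \<in> carrier ?M" if "x \<in> carrier G" for x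
    using h_F[OF that] \<iota>_L by (auto simp: \<psi>_def matrix_monoid_def)
  have \<psi>_mult: "\<psi> (x \<otimes>\<^bsub>G\<^esub> y) = \<psi> x \<otimes>\<^bsub>?M\<^esub> \<psi> y" if x: "x \<in> carrier G" and y: "y \<in> carrier G" for x y
  proof
    fix p :: "nat \<times> nat"
    obtain i j where p: "p = (i, j)" by fastforce
    show "\<psi> (x \<otimes>\<^bsub>G\<^esub> y) p = (\<psi> x \<otimes>\<^bsub>?M\<^esub> \<psi> y) p"
    proof (cases "p \<in> ?I")
      case True
      then have ij: "i < m" "j < m" by (simp_all add: p)
      have "\<psi> (x \<otimes>\<^bsub>G\<^esub> y) p = \<iota> (\<Oplus>\<^bsub>K\<^esub>k\<in>{..<m}. h x (i, k) \<otimes>\<^bsub>K\<^esub> h y (k, j))"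
        using ij by (simp add: \<psi>_def p h_mult[OF x y]) (simp add: matrix_monoid_def)
      also have "\<dots> = (\<Oplus>\<^bsub>L\<^esub>k\<in>{..<m}. \<iota> (h x (i, k) \<otimes>\<^bsub>K\<^esub> h y (k, j)))"
        using ij h_F[OF x] h_F[OF y] by (intro \<iota>_sum) (auto intro: F_mult)
      also have "\<dots> = (\<Oplus>\<^bsub>L\<^esub>k\<in>{..<m}. \<psi> x (i, k) \<otimes>\<^bsub>L\<^esub> \<psi> y (k, j))"
        using ij h_F[OF x] h_F[OF y]
        by (intro L.finsum_cong') (auto simp: \<psi>_def \<iota>_mult \<iota>_L)
      also have "\<dots> = (\<psi> x \<otimes>\<^bsub>?M\<^esub> \<psi> y) p"
        using ij by (simp add: matrix_monoid_def p)
      finally show ?thesis .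
    next
      case False
      then show ?thesis by (simp add: \<psi>_def matrix_monoid_def)
    qed
  qed
  have \<psi>_one: "\<psi> \<one>\<^bsub>G\<^esub> = \<one>\<^bsub>?M\<^esub>"
  proof -
    have "\<iota> \<one>\<^bsub>K\<^esub> = \<one>\<^bsub>L\<^esub>" "\<iota> \<zero>\<^bsub>K\<^esub> = \<zero>\<^bsub>L\<^esub>"
      using \<iota>.hom_one \<iota>.hom_zero by simp_all
    then show ?thesis
      by (auto simp: fun_eq_iff \<psi>_def h_one matrix_monoid_def restrict_def)
  qed
  have \<psi>_hom: "\<psi> \<in> hom G (GL m L)"
  proof (rule homI)
    fix x assume x: "x \<in> carrier G"
    have "\<psi> (inv\<^bsub>G\<^esub> x) \<otimes>\<^bsub>?M\<^esub> \<psi> x = \<one>\<^bsub>?M\<^esub>" "\<psi> x \<otimes>\<^bsub>?M\<^esub> \<psi> (inv\<^bsub>G\<^esub> x) = \<one>\<^bsub>?M\<^esub>"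
      using x \<psi>_mult[of "inv\<^bsub>G\<^esub> x" x] \<psi>_mult[of x "inv\<^bsub>G\<^esub> x"] \<psi>_one by simp_all
    then have "\<psi> x \<in> Units ?M"
      unfolding Units_def using \<psi>_in[OF x] \<psi>_in[OF G.inv_closed[OF x]] by blast
    then show "\<psi> x \<in> carrier (GL m L)"
      by (simp add: GL_def units_of_def)
  qed (simp add: GL_def units_of_def \<psi>_mult)
  then interpret \<psi>: group_hom G "GL m L" \<psi>
    using L.group_GL by (simp add: group_hom_def group_hom_axioms_def G)
  have "inj_on \<psi> (carrier G)"
  proof (rule inj_onI)
    fix x y assume x: "x \<in> carrier G" and y: "y \<in> carrier G" and eq: "\<psi> x = \<psi> y"
    have "h x = h y"
    proof (rule PiE_ext[OF h_in[OF x] h_in[OF y]])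
      fix p assume p: "p \<in> ?I"
      then have "\<iota> (h x p) = \<iota> (h y p)"
        using fun_cong[OF eq, of p] by (simp add: \<psi>_def)
      then show "h x p = h y p"
        using inj p h_F[OF x] h_F[OF y] by (auto simp: inj_on_def)
    qed
    then show "x = y" using inj_h x y by (auto simp: inj_on_def)
  qed
  then have "\<psi> \<in> iso G ((GL m L)\<lparr>carrier := \<psi> ` carrier G\<rparr>)"
    using \<psi>_hom by (auto simp: iso_def hom_def bij_betw_def)
  then show ?thesis
    unfolding linear_group_def is_iso_def
    using \<open>field L\<close> m \<psi>.img_is_subgroup by blast
qed

end

theory Submission
  imports Defs "HOL-Algebra.Algebraic_Closure_Type"
begin

text \<open>
  Let \<open>H\<close> be a subgroup of finite index with a surjection \<open>f\<close> onto the free group \<open>F\<close> of rank 2.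
  Sanov's matrices (1 2; 0 1) and (1 0; 2 1) generate a free group, by ping-pong, so they give
  a faithful representation of \<open>F\<close> on \<open>\<rat>\<^sup>2\<close> (\<open>rep_kernel_sanov\<close>).  Composing with \<open>f\<close> yields a
  representation of \<open>H\<close> with kernel \<open>ker f\<close>, and inducing it to \<open>G\<close> yields a representation of \<open>G\<close>
  of finite degree, because the index is finite (\<open>matrix_rep_induced\<close>).  Let \<open>N\<close> be its kernel.
  Then \<open>G/N\<close> is linear (\<open>matrix_rep_quotient_linear\<close>), and \<open>N\<close> is contained in \<open>ker f\<close>
  (\<open>rep_kernel_induced\<close>), so that \<open>F\<close> is a quotient of the subgroup \<open>H/N\<close> of \<open>G/N\<close>.

  It remains to see that no subgroup \<open>S\<close> of finite index in \<open>G/N\<close> is solvable.  Such an \<open>S\<close> contains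
  a positive power of every element, so the elements of \<open>H\<close> whose class lies in \<open>S\<close> are mapped by
  \<open>f\<close> onto a subgroup \<open>E\<close> of \<open>F\<close> containing positive powers of both generators.  A commutator
  computation without cancellation shows that every derived subgroup of such an \<open>E\<close> is nontrivial
  (\<open>derived_series_framed\<close>).  As \<open>f\<close> kills \<open>N\<close>, a trivial term of the derived series of \<open>S\<close> would
  force the corresponding term for \<open>E\<close> to be trivial (\<open>not_solvable_if_free_subquotient\<close>).
\<close>

section \<open>Matrix representations\<close>

text \<open>Rows and columns are indexed by an arbitrary finite set, since induced representations are
  naturally indexed by pairs.  A matrix is the restriction of the function \<open>R x\<close> to \<open>I \<times> I\<close>; hence
  \<open>rep_kernel\<close> compares matrices entrywise there instead of comparing functions.\<close>

definition matrix_rep :: "('a, 'b) monoid_scheme \<Rightarrow> 'i set \<Rightarrow> ('a \<Rightarrow> 'i \<Rightarrow> 'i \<Rightarrow> 'k::field) \<Rightarrow> bool"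
  where "matrix_rep G I R \<longleftrightarrow> finite I \<and> I \<noteq> {} \<and>
    (\<forall>i\<in>I. \<forall>j\<in>I. R \<one>\<^bsub>G\<^esub> i j = of_bool (i = j)) \<and>
    (\<forall>x\<in>carrier G. \<forall>y\<in>carrier G. \<forall>i\<in>I. \<forall>j\<in>I. R (x \<otimes>\<^bsub>G\<^esub> y) i j = (\<Sum>k\<in>I. R x i k * R y k j))"

definition rep_kernel :: "('a, 'b) monoid_scheme \<Rightarrow> 'i set \<Rightarrow> ('a \<Rightarrow> 'i \<Rightarrow> 'i \<Rightarrow> 'k::field) \<Rightarrow> 'a set"
  where "rep_kernel G I R = {x \<in> carrier G. \<forall>i\<in>I. \<forall>j\<in>I. R x i j = of_bool (i = j)}"

lemma finsum_ring_of_type_algebra: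
  "finite A \<Longrightarrow> finsum (ring_of_type_algebra :: 'k::field ring) f A = sum f A"
proof (induction A rule: finite_induct)
  interpret K: field "ring_of_type_algebra :: 'k ring"
    by (rule field_from_type_algebra)
  {
    case empty
    show ?case by (simp only: K.finsum_empty sum.empty) (simp add: ring_of_type_algebra_def)
  next
    case (insert x A)
    then have "finsum (ring_of_type_algebra :: 'k ring) f (insert x A)
        = f x \<oplus>\<^bsub>ring_of_type_algebra\<^esub> finsum ring_of_type_algebra f A"
      by (intro K.finsum_insert) (auto simp: ring_of_type_algebra_def)
    with insert show ?case by (simp add: ring_of_type_algebra_def)
  }
qed

text \<open>Numbering the index set turns \<open>R\<close> into a homomorphism to a general linear group over the
  field given by the type \<open>'k\<close>, and the first isomorphism theorem applies.\<close>

lemma matrix_rep_quotient_linear: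
  assumes G: "group G" and R: "matrix_rep G I (R :: _ \<Rightarrow> _ \<Rightarrow> _ \<Rightarrow> 'k::field)"
  shows "rep_kernel G I R \<lhd> G" and "linear_group (G Mod rep_kernel G I R)"
proof -
  interpret G: group G by fact
  let ?K = "ring_of_type_algebra :: 'k ring"
  interpret K: field ?K by (rule field_from_type_algebra)
  define m where "m = card I"
  let ?M = "matrix_monoid m ?K" and ?J = "{..<m} \<times> {..<m}"
  have m: "1 \<le> m"
    using R by (simp add: m_def matrix_rep_def Suc_le_eq card_gt_0_iff)
  obtain e where e: "bij_betw e {..<m} I"
    using R ex_bij_betw_nat_finite[of I] by (auto simp: m_def matrix_rep_def atLeast0LessThan)
  have e_I: "e i \<in> I" if "i < m" for i
    using e that by (auto simp: bij_betw_def)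
  have e_inj: "e i = e j \<longleftrightarrow> i = j" if "i < m" "j < m" for i j
    using e that by (auto simp: bij_betw_def inj_on_def)
  define \<psi> where "\<psi> = (\<lambda>x. \<lambda>(i, j)\<in>?J. R x (e i) (e j))"
  have \<psi>_in: "\<psi> x \<in> carrier ?M" for x
    by (auto simp: \<psi>_def matrix_monoid_def ring_of_type_algebra_def)
  have \<psi>_one: "\<psi> \<one>\<^bsub>G\<^esub> = \<one>\<^bsub>?M\<^esub>"
    using R e_I e_inj
    by (auto simp: \<psi>_def matrix_monoid_def ring_of_type_algebra_def matrix_rep_def fun_eq_iff
        restrict_def)
  have \<psi>_mult: "\<psi> (x \<otimes>\<^bsub>G\<^esub> y) = \<psi> x \<otimes>\<^bsub>?M\<^esub> \<psi> y" if "x \<in> carrier G" "y \<in> carrier G" for x y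
  proof -
    have "R (x \<otimes>\<^bsub>G\<^esub> y) (e i) (e j) = (\<Sum>k<m. R x (e i) (e k) * R y (e k) (e j))"
      if "i < m" "j < m" for i j
      using R \<open>x \<in> carrier G\<close> \<open>y \<in> carrier G\<close> e_I that
      by (simp add: matrix_rep_def sum.reindex_bij_betw[OF e, symmetric])
    then show ?thesis
      by (auto simp: \<psi>_def matrix_monoid_def fun_eq_iff finsum_ring_of_type_algebra)
         (simp add: ring_of_type_algebra_def)
  qed
  have \<psi>_hom: "\<psi> \<in> hom G (GL m ?K)"
  proof (rule homI)
    fix x assume x: "x \<in> carrier G"
    have "\<psi> (inv\<^bsub>G\<^esub> x) \<otimes>\<^bsub>?M\<^esub> \<psi> x = \<one>\<^bsub>?M\<^esub>" "\<psi> x \<otimes>\<^bsub>?M\<^esub> \<psi> (inv\<^bsub>G\<^esub> x) = \<one>\<^bsub>?M\<^esub>"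
      using x \<psi>_mult[of "inv\<^bsub>G\<^esub> x" x] \<psi>_mult[of x "inv\<^bsub>G\<^esub> x"] \<psi>_one by simp_all
    then have "\<psi> x \<in> Units ?M"
      unfolding Units_def using \<psi>_in by blast
    then show "\<psi> x \<in> carrier (GL m ?K)"
      by (simp add: GL_def units_of_def)
  qed (simp add: GL_def units_of_def \<psi>_mult)
  interpret GL: group "GL m ?K" by (rule K.group_GL)
  interpret \<psi>: group_hom G "GL m ?K" \<psi>
    using \<psi>_hom by (simp add: group_hom_def group_hom_axioms_def G GL.is_group)
  have "R x i j = of_bool (i = j)"
    if "\<psi> x = \<psi> \<one>\<^bsub>G\<^esub>" "i \<in> I" "j \<in> I" for x i j
  proof -
    obtain i' j' where "i' < m" "j' < m" "i = e i'" "j = e j'"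
      using \<open>i \<in> I\<close> \<open>j \<in> I\<close> e unfolding bij_betw_def by blast
    then show ?thesis
      using fun_cong[OF that(1), of "(i', j')"] R that(2,3) by (simp add: \<psi>_def matrix_rep_def)
  qed
  moreover have "\<psi> x = \<psi> \<one>\<^bsub>G\<^esub>" if "\<forall>i\<in>I. \<forall>j\<in>I. R x i j = of_bool (i = j)" for x
    using that R e_I by (auto simp: \<psi>_def matrix_rep_def fun_eq_iff restrict_def)
  ultimately have ker: "rep_kernel G I R = kernel G (GL m ?K) \<psi>"
    unfolding rep_kernel_def kernel_def \<psi>.hom_one[symmetric] by blast
  show normal: "rep_kernel G I R \<lhd> G"
    unfolding ker by (rule \<psi>.normal_kernel)
  let ?H = "\<psi> ` carrier G"
  have H: "subgroup ?H (GL m ?K)" by (rule \<psi>.img_is_subgroup)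
  have "group_hom G ((GL m ?K)\<lparr>carrier := ?H\<rparr>) \<psi>"
    using \<psi>_hom GL.subgroup_imp_group[OF H] G
    by (auto simp: group_hom_def group_hom_axioms_def hom_def)
  from group_hom.FactGroup_iso[OF this]
  have "G Mod rep_kernel G I R \<cong> (GL m ?K)\<lparr>carrier := ?H\<rparr>"
    unfolding ker by (simp add: kernel_def)
  then show "linear_group (G Mod rep_kernel G I R)"
    using linear_group_over_any_field[OF normal.factorgroup_is_group[OF normal] K.field_axioms m H]
    by blast
qed

lemma matrix_rep_hom:
  assumes "matrix_rep F I R" "f \<in> hom G F" "f \<one>\<^bsub>G\<^esub> = \<one>\<^bsub>F\<^esub>"
  shows "matrix_rep G I (\<lambda>x. R (f x))"
  using assms by (auto simp: matrix_rep_def hom_def Pi_def)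

section \<open>Induced representations\<close>

text \<open>Phrasing a transversal through \<open>x \<otimes> inv t \<in> H\<close> instead of through cosets is what the matrix
  entries of an induced representation ask for.\<close>

lemma (in group) finite_right_transversal:
  assumes H: "subgroup H G" and fin: "finite (rcosets H)"
  obtains T where "finite T" "T \<subseteq> carrier G" "\<And>x. x \<in> carrier G \<Longrightarrow> \<exists>!t\<in>T. x \<otimes> inv t \<in> H"
proof -
  interpret H: subgroup H G by fact
  define r where "r C = (SOME x. x \<in> C)" for C :: "'a set"
  have r: "r C \<in> C" if "C \<in> rcosets H" for C
    using H.rcosets_non_empty[OF that] by (auto simp: r_def some_in_eq)
  have r_carr: "r C \<in> carrier G" if "C \<in> rcosets H" for C
    using r[OF that] H.rcosets_carrier[OF is_group that] by blast
  have r_coset: "H #> r C = C" if "C \<in> rcosets H" for C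
    using that r[OF that] repr_independence[OF _ _ H] by (auto simp: RCOSETS_def)
  show thesis
  proof
    show "finite (r ` (rcosets H))" using fin by simp
    show "r ` (rcosets H) \<subseteq> carrier G" using r_carr by blast
    fix x assume x: "x \<in> carrier G"
    have iff: "x \<otimes> inv t \<in> H \<longleftrightarrow> H #> x = H #> t" if "t \<in> carrier G" for t
      using H.rcos_module[OF is_group that x] repr_independence[OF _ that H]
        repr_independenceD[OF H x] by metis
    have "H #> x \<in> rcosets H" using x by (auto simp: RCOSETS_def)
    then show "\<exists>!t\<in>r ` (rcosets H). x \<otimes> inv t \<in> H"
      using iff r_carr r_coset by (intro ex1I[of _ "r (H #> x)"]) auto
  qed
qed

text \<open>The block in position \<open>(s, t)\<close>, for \<open>s\<close> and \<open>t\<close> in a right transversal of \<open>H\<close>, is the value of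
  \<open>R\<close> at \<open>s x t\<inverse>\<close> when this element lies in \<open>H\<close>, and the zero block otherwise.\<close>

definition induced_rep ::
  "('a, 'b) monoid_scheme \<Rightarrow> 'a set \<Rightarrow> ('a \<Rightarrow> 'i \<Rightarrow> 'i \<Rightarrow> 'k::field) \<Rightarrow> 'a \<Rightarrow> 'a \<times> 'i \<Rightarrow> 'a \<times> 'i \<Rightarrow> 'k"
  where "induced_rep G H R x = (\<lambda>(s, i) (t, j).
    if s \<otimes>\<^bsub>G\<^esub> x \<otimes>\<^bsub>G\<^esub> inv\<^bsub>G\<^esub> t \<in> H then R (s \<otimes>\<^bsub>G\<^esub> x \<otimes>\<^bsub>G\<^esub> inv\<^bsub>G\<^esub> t) i j else 0)"

context group
begin

context
  fixes H T I and R :: "'a \<Rightarrow> 'i \<Rightarrow> 'i \<Rightarrow> 'k::field"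
  assumes H: "subgroup H G" and R: "matrix_rep (G\<lparr>carrier := H\<rparr>) I R"
    and T: "finite T" "T \<subseteq> carrier G" and transversal: "\<And>x. x \<in> carrier G \<Longrightarrow> \<exists>!t\<in>T. x \<otimes> inv t \<in> H"
begin

text \<open>The matrices are block monomial: for given \<open>s\<close> and \<open>x\<close>, only the block column of the \<open>u\<close>
  representing the coset of \<open>s x\<close> is nonzero.  The matrix product therefore collapses to the single
  term belonging to \<open>s (x y) t\<inverse> = (s x u\<inverse>) (u y t\<inverse>)\<close>.\<close>

lemma matrix_rep_induced: "matrix_rep G (T \<times> I) (induced_rep G H R)"
proof -
  interpret H: subgroup H G by fact
  have I: "finite I" "I \<noteq> {}" using R by (auto simp: matrix_rep_def)
  have "T \<noteq> {}" using transversal[OF one_closed] by blast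
  have unique: "s \<otimes> inv t \<in> H \<longleftrightarrow> s = t" if "s \<in> T" "t \<in> T" for s t
  proof
    have "s \<in> carrier G" using that T by blast
    then have "s \<otimes> inv s \<in> H" by simp
    then show "s \<otimes> inv t \<in> H \<Longrightarrow> s = t"
      using transversal[OF \<open>s \<in> carrier G\<close>] that by blast
    then show "s = t \<Longrightarrow> s \<otimes> inv t \<in> H" using \<open>s \<otimes> inv s \<in> H\<close> by blast
  qed
  have one: "induced_rep G H R \<one> p q = of_bool (p = q)" if "p \<in> T \<times> I" "q \<in> T \<times> I" for p q
  proof -
    obtain s i t j where pq: "p = (s, i)" "q = (t, j)" by fastforce
    with that have st: "s \<in> T" "t \<in> T" "i \<in> I" "j \<in> I" by auto
    then have "s \<in> carrier G" "t \<in> carrier G" using T by auto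
    then show ?thesis
      using R st unique[of s t] by (auto simp: pq induced_rep_def matrix_rep_def)
  qed
  have mult: "induced_rep G H R (x \<otimes> y) p q
      = (\<Sum>r\<in>T \<times> I. induced_rep G H R x p r * induced_rep G H R y r q)"
    if x: "x \<in> carrier G" and y: "y \<in> carrier G" and "p \<in> T \<times> I" "q \<in> T \<times> I" for x y p q
  proof -
    obtain s i t j where pq: "p = (s, i)" "q = (t, j)" by fastforce
    with that have st: "s \<in> T" "t \<in> T" "i \<in> I" "j \<in> I" by auto
    then have carr: "s \<in> carrier G" "t \<in> carrier G" using T by auto
    obtain u where u: "u \<in> T" "s \<otimes> x \<otimes> inv u \<in> H"
      and u_unique: "\<And>v. v \<in> T \<Longrightarrow> s \<otimes> x \<otimes> inv v \<in> H \<Longrightarrow> v = u"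
      using transversal[of "s \<otimes> x"] x carr by (metis m_closed)
    have u_carr: "u \<in> carrier G" using u T by blast
    let ?h = "s \<otimes> x \<otimes> inv u" and ?k = "u \<otimes> y \<otimes> inv t"
    have inv_cancel: "inv u \<otimes> (u \<otimes> z) = z" if "z \<in> carrier G" for z
      using that u_carr by (simp add: m_assoc[symmetric])
    have eq: "s \<otimes> (x \<otimes> y) \<otimes> inv t = ?h \<otimes> ?k"
      using x y carr u_carr by (simp add: m_assoc inv_cancel)
    have k_carr: "?k \<in> carrier G" using y carr u_carr by simp
    have mem: "?h \<otimes> ?k \<in> H \<longleftrightarrow> ?k \<in> H"
    proof
      assume "?h \<otimes> ?k \<in> H"
      then have "inv ?h \<otimes> (?h \<otimes> ?k) \<in> H" using u by blast
      then show "?k \<in> H" using k_carr u(2) by (simp add: m_assoc[symmetric])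
    qed (use u in blast)
    have "(\<Sum>r\<in>T \<times> I. induced_rep G H R x p r * induced_rep G H R y r q)
        = (\<Sum>v\<in>T. \<Sum>k\<in>I. induced_rep G H R x p (v, k) * induced_rep G H R y (v, k) q)"
      by (simp add: sum.cartesian_product)
    also have "\<dots> = (\<Sum>v\<in>{u}. \<Sum>k\<in>I. induced_rep G H R x p (v, k) * induced_rep G H R y (v, k) q)"
      using T(1) u(1) u_unique
      by (intro sum.mono_neutral_right ballI sum.neutral) (auto simp: pq induced_rep_def)
    also have "\<dots> = (\<Sum>k\<in>I. R ?h i k * (if ?k \<in> H then R ?k k j else 0))"
      using u by (simp add: pq induced_rep_def)
    also have "\<dots> = (if ?k \<in> H then R (?h \<otimes> ?k) i j else 0)"
      using R u(2) st by (simp add: matrix_rep_def)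
    also have "\<dots> = induced_rep G H R (x \<otimes> y) p q"
      by (simp add: pq induced_rep_def eq mem)
    finally show ?thesis by simp
  qed
  show ?thesis
    unfolding matrix_rep_def using T(1) \<open>T \<noteq> {}\<close> I one mult by simp
qed

text \<open>The representative \<open>t\<close> of the coset \<open>H\<close> lies in \<open>H\<close>.  A diagonal block that is the identity
  cannot be a zero block, so \<open>t x t\<inverse>\<close> lies in \<open>H\<close> and in the kernel of \<open>R\<close>, and conjugating back
  by \<open>t \<in> H\<close> gives the claim for \<open>x\<close>.\<close>

lemma rep_kernel_induced: "rep_kernel G (T \<times> I) (induced_rep G H R) \<subseteq> rep_kernel (G\<lparr>carrier := H\<rparr>) I R"
proof
  interpret H: subgroup H G by fact
  interpret S: group "G\<lparr>carrier := H\<rparr>" by (rule subgroup_imp_group[OF H])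
  interpret N: normal "rep_kernel (G\<lparr>carrier := H\<rparr>) I R" "G\<lparr>carrier := H\<rparr>"
    by (rule matrix_rep_quotient_linear(1)[OF S.is_group R])
  fix x assume x: "x \<in> rep_kernel G (T \<times> I) (induced_rep G H R)"
  then have x_carr: "x \<in> carrier G" by (simp add: rep_kernel_def)
  obtain i where i: "i \<in> I" using R by (auto simp: matrix_rep_def)
  obtain t where t: "t \<in> T" "\<one> \<otimes> inv t \<in> H" using transversal[OF one_closed] by blast
  have t_carr: "t \<in> carrier G" using t T by blast
  have t_H: "t \<in> H" using t t_carr H.m_inv_closed[of "inv t"] by simp
  have entry: "induced_rep G H R x (t, i) (t, j) = of_bool (i = j)" if "i \<in> I" "j \<in> I" for i j
    using x that t by (auto simp: rep_kernel_def)
  have conj_H: "t \<otimes> x \<otimes> inv t \<in> H"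
    using entry[OF i i] by (auto simp: induced_rep_def split: if_splits)
  then have "t \<otimes> x \<otimes> inv t \<in> rep_kernel (G\<lparr>carrier := H\<rparr>) I R"
    using entry by (auto simp: rep_kernel_def induced_rep_def)
  from N.inv_op_closed1[OF _ this, of t]
  have "inv t \<otimes> (t \<otimes> x \<otimes> inv t) \<otimes> t \<in> rep_kernel (G\<lparr>carrier := H\<rparr>) I R"
    using t_H by (simp add: m_inv_consistent[OF H])
  moreover have "inv t \<otimes> (t \<otimes> x \<otimes> inv t) \<otimes> t = x"
    using x_carr t_carr by (simp add: m_assoc inv_solve_left')
  ultimately show "x \<in> rep_kernel (G\<lparr>carrier := H\<rparr>) I R" by simp
qed

end

end

section \<open>Sanov's faithful representation of the free group\<close>

text \<open>The free group is presented by reduced words, so the representation is most easily given by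
  the action of single letters on column vectors.  The generator \<open>x\<^sub>0\<close> acts by (1 2; 0 1); every
  other generator acts by (1 0; 2 1).  Only \<open>x\<^sub>0\<close> and \<open>x\<^sub>1\<close> occur in the free group of rank 2.\<close>

fun letter_act :: "nat \<times> bool \<Rightarrow> rat \<times> rat \<Rightarrow> rat \<times> rat"
  where "letter_act (i, s) (p, q) =
    (let c = if s then 2 else - 2 in if i = 0 then (p + c * q, q) else (p, q + c * p))"

abbreviation word_act :: "(nat \<times> bool) list \<Rightarrow> rat \<times> rat \<Rightarrow> rat \<times> rat"
  where "word_act \<equiv> foldr letter_act"

text \<open>The matrix entries, where \<open>True\<close> indexes the first coordinate and \<open>False\<close> the second.\<close>

definition sanov :: "(nat \<times> bool) list \<Rightarrow> bool \<Rightarrow> bool \<Rightarrow> rat"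
  where "sanov w i j = (if i then fst else snd) (word_act w (if j then (1, 0) else (0, 1)))"

lemma letter_act_inverse: "letter_act a (letter_act (letter_inv a) v) = v"
  by (cases a; cases v) (auto simp: letter_inv_def Let_def)

lemma word_act_push: "word_act (push_letter a w) v = letter_act a (word_act w v)"
  by (cases w) (auto simp: letter_act_inverse)

lemma word_act_mult: "word_act (foldr push_letter u w) v = word_act u (word_act w v)"
  by (induction u) (auto simp: word_act_push)

lemma word_act_sanov:
  "word_act w (p, q) = (sanov w True True * p + sanov w True False * q,
    sanov w False True * p + sanov w False False * q)"
proof (induction w)
  case Nil
  show ?case by (simp add: sanov_def)
next
  case (Cons a w)
  have "word_act w (1, 0) = (sanov w True True, sanov w False True)"
    "word_act w (0, 1) = (sanov w True False, sanov w False False)"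
    by (simp_all add: sanov_def)
  then show ?case
    unfolding sanov_def[of "a # w"]
    by (cases a) (simp add: Cons Let_def algebra_simps)
qed

lemma matrix_rep_sanov: "matrix_rep (free_group n) UNIV sanov"
proof -
  have "sanov (foldr push_letter u w) i j = (\<Sum>k\<in>UNIV. sanov u i k * sanov w k j)" for u w i j
  proof -
    define v where "v = word_act w (if j then (1, 0) else (0, 1))"
    have "v = (sanov w True j, sanov w False j)"
      by (simp add: v_def sanov_def)
    moreover have "sanov (foldr push_letter u w) i j = (if i then fst else snd) (word_act u v)"
      by (simp add: sanov_def[of "foldr push_letter u w"] word_act_mult v_def)
    ultimately show ?thesis
      by (simp add: word_act_sanov UNIV_bool)
  qed
  then show ?thesis
    by (auto simp: matrix_rep_def free_group_def sanov_def)
qed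

text \<open>The table for ping-pong: on vectors where \<open>q\<close> is the smaller coordinate in absolute value
  live the regions of \<open>x\<^sub>0\<close> (coordinates of equal sign) and of its inverse (opposite signs), and
  symmetrically for \<open>x\<^sub>1\<close>.  A letter changes one coordinate by twice the other, which makes it
  dominate unless the vector lies in the region of the inverse letter.  The sign conditions are spelled out to make the defining inequalities
  linear.\<close>

fun pong_region :: "nat \<times> bool \<Rightarrow> (rat \<times> rat) set"
  where "pong_region (i, s) = {(p, q).
    let r = (if s then q else - q) in
    if i = 0 then 0 < r \<and> r < p \<or> p < r \<and> r < 0 else 0 < p \<and> p < r \<or> r < p \<and> p < 0}"

lemma letter_act_pong:
  assumes "v \<in> pong_region b" "b \<noteq> letter_inv a" "fst a < 2" "fst b < 2"
  shows "letter_act a v \<in> pong_region a"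
proof -
  obtain i s j t p q where [simp]: "a = (i, s)" "b = (j, t)" "v = (p, q)"
    by (metis surj_pair)
  show ?thesis
    using assms by (cases s; cases t) (auto simp: Let_def letter_inv_def less_2_cases_iff split: if_splits)
qed

text \<open>The starting vector is the basis vector that the last letter moves.  It lies in no region,
  yet the last letter already sends it into its own region; hence a nonempty reduced word moves it.\<close>

lemma word_act_pong:
  assumes "reduced w" "w \<noteq> []" "fst ` set w \<subseteq> {..<2}"
  shows "word_act w (if fst (last w) = 0 then (0, 1) else (1, 0)) \<in> pong_region (hd w)"
  using assms
proof (induction w)
  case (Cons a w)
  show ?case
  proof (cases w)
    case Nil
    then show ?thesis by (cases a) (auto simp: Let_def)
  next
    case (Cons b u)
    then have "letter_act a (word_act w (if fst (last w) = 0 then (0, 1) else (1, 0))) \<in> pong_region a"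
      using Cons.IH Cons.prems by (intro letter_act_pong[where b = "hd w"]) (auto simp: reduced_Cons)
    then show ?thesis using Cons by simp
  qed
qed simp

lemma rep_kernel_sanov: "rep_kernel (free_group 2) UNIV sanov = {[]}"
proof -
  have "w = []" if w: "w \<in> rep_kernel (free_group 2) UNIV sanov" for w
  proof (rule ccontr)
    assume "w \<noteq> []"
    have "word_act w v = v" for v
      using w by (cases v) (simp add: word_act_sanov rep_kernel_def)
    then have "(if fst (last w) = 0 then (0, 1) else (1, 0)) \<in> pong_region (hd w)"
      using word_act_pong[of w] w \<open>w \<noteq> []\<close> by (simp add: rep_kernel_def free_group_def)
    then show False by (cases "hd w") (auto simp: Let_def split: if_splits)
  qed
  then show ?thesis
    by (auto simp: rep_kernel_def free_group_def sanov_def reduced_def)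
qed

section \<open>The derived series of a subgroup of the free group\<close>

text \<open>Words framed by a letter survive concatenation without cancellation: within one
  set, and with the words framed by a letter of another generator and the inverses of those.\<close>

definition framed :: "nat \<times> bool \<Rightarrow> (nat \<times> bool) list set"
  where "framed a = {w. reduced w \<and> w \<noteq> [] \<and> hd w = a \<and> last w = a}"

lemma reduced_append:
  "reduced (u @ v) \<longleftrightarrow> reduced u \<and> reduced v \<and> (u = [] \<or> v = [] \<or> hd v \<noteq> letter_inv (last u))"
  by (auto simp: reduced_def successively_append_iff)

lemma inv_free_group:
  assumes "u \<in> carrier (free_group n)"
  shows "inv\<^bsub>free_group n\<^esub> u = rev (map letter_inv u)"
proof (rule group.inv_equality[OF group_free_group])
  show "rev (map letter_inv u) \<in> carrier (free_group n)"
    using assms by (auto simp: free_group_def reduced_inverse)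
qed (use assms in \<open>simp_all add: free_group_def foldr_push_inverse\<close>)

lemma mult_framed:
  assumes "u \<in> framed a" "v \<in> framed a"
  shows "u \<otimes>\<^bsub>free_group n\<^esub> v \<in> framed a"
proof -
  have "reduced (u @ v)"
    using assms by (cases a) (auto simp: framed_def reduced_append letter_inv_def)
  then have "foldr push_letter (u @ v) [] = u @ v"
    by (rule foldr_push_Nil)
  then have "u \<otimes>\<^bsub>free_group n\<^esub> v = u @ v"
    using assms by (simp add: free_group_def framed_def foldr_push_Nil)
  with assms \<open>reduced (u @ v)\<close> show ?thesis
    by (simp add: framed_def)
qed

lemma pow_framed:
  assumes "u \<in> framed a" "0 < k"
  shows "u [^]\<^bsub>free_group n\<^esub> (k::nat) \<in> framed a"
  using assms(2)
proof (induction k rule: nat_induct_non_zero)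
  case 1
  have "reduced u" using assms by (simp add: framed_def)
  then show ?case
    using assms by (simp add: nat_pow_def) (simp add: free_group_def)
next
  case (Suc k)
  then show ?case using assms mult_framed by (simp add: nat_pow_def)
qed

text \<open>The commutator \<open>[u, v]\<close> starts with \<open>a\<close> but ends with the inverse of \<open>b\<close>.  Multiplying it by
  the commutator \<open>[v\<inverse>, u\<inverse>]\<close> yields \<open>u v u\<inverse> v\<inverse> v\<inverse> u\<inverse> v u\<close>.  This word is reduced as it
  stands and again framed by \<open>a\<close>, so the argument can be iterated.\<close>

lemma derived_framed:
  assumes D: "subgroup D (free_group n)" and u: "u \<in> D" "u \<in> framed a" and v: "v \<in> D" "v \<in> framed b"
    and ab: "fst a \<noteq> fst b"
  shows "\<exists>w\<in>derived (free_group n) D. w \<in> framed a"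
proof -
  let ?F = "free_group n"
  interpret F: group ?F by (rule group_free_group)
  let ?U = "rev (map letter_inv u)" and ?V = "rev (map letter_inv v)"
  have carr: "u \<in> carrier ?F" "v \<in> carrier ?F" using D u v subgroup.subset by blast+
  have UV: "?U \<in> D" "?V \<in> D" "?U \<in> carrier ?F" "?V \<in> carrier ?F"
    using carr u v D subgroup.m_inv_closed[OF D] subgroup.subset[OF D]
    by (auto simp flip: inv_free_group)
  have inv_UV: "inv\<^bsub>?F\<^esub> ?U = u" "inv\<^bsub>?F\<^esub> ?V = v"
    using carr by (simp_all flip: inv_free_group)
  define c where "c = u \<otimes>\<^bsub>?F\<^esub> v \<otimes>\<^bsub>?F\<^esub> ?U \<otimes>\<^bsub>?F\<^esub> ?V"
  define d where "d = ?V \<otimes>\<^bsub>?F\<^esub> ?U \<otimes>\<^bsub>?F\<^esub> v \<otimes>\<^bsub>?F\<^esub> u"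
  have d_eq: "d = ?V \<otimes>\<^bsub>?F\<^esub> ?U \<otimes>\<^bsub>?F\<^esub> inv\<^bsub>?F\<^esub> ?V \<otimes>\<^bsub>?F\<^esub> inv\<^bsub>?F\<^esub> ?U"
    unfolding d_def inv_UV ..
  have "c \<in> derived_set ?F D"
    using u(1) v(1) carr unfolding c_def by (simp flip: inv_free_group) blast
  moreover have "d \<in> derived_set ?F D"
    using UV(1,2) d_eq by blast
  ultimately have "c \<otimes>\<^bsub>?F\<^esub> d \<in> derived ?F D"
    unfolding derived_def by (intro generate.eng generate.incl)
  moreover have "c \<otimes>\<^bsub>?F\<^esub> d = u @ v @ ?U @ ?V @ ?V @ ?U @ v @ u"
    and "u @ v @ ?U @ ?V @ ?V @ ?U @ v @ u \<in> framed a"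
  proof -
    have red: "reduced (u @ v @ ?U @ ?V @ ?V @ ?U @ v @ u)"
      using u(2) v(2) ab
      by (auto simp: reduced_append framed_def reduced_inverse hd_rev last_rev hd_map last_map
          letter_inv_def prod_eq_iff)
    then show "u @ v @ ?U @ ?V @ ?V @ ?U @ v @ u \<in> framed a"
      using u(2) by (simp add: framed_def)
    have "c \<otimes>\<^bsub>?F\<^esub> d = u \<otimes>\<^bsub>?F\<^esub> (v \<otimes>\<^bsub>?F\<^esub> (?U \<otimes>\<^bsub>?F\<^esub> (?V \<otimes>\<^bsub>?F\<^esub> (?V \<otimes>\<^bsub>?F\<^esub> (?U \<otimes>\<^bsub>?F\<^esub> (v \<otimes>\<^bsub>?F\<^esub> u))))))"
      using carr UV by (simp add: c_def d_def F.m_assoc)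
    also have "\<dots> = foldr push_letter (u @ v @ ?U @ ?V @ ?V @ ?U @ v @ u) []"
      using carr(1) by (simp add: free_group_def foldr_push_Nil)
    finally show "c \<otimes>\<^bsub>?F\<^esub> d = u @ v @ ?U @ ?V @ ?V @ ?U @ v @ u"
      using foldr_push_Nil[OF red] by simp
  qed
  ultimately show ?thesis by auto
qed

lemma derived_series_framed:
  assumes E: "subgroup E (free_group n)" and "E \<inter> framed a \<noteq> {}" "E \<inter> framed b \<noteq> {}"
    and ab: "fst a \<noteq> fst b"
  shows "(derived (free_group n) ^^ k) E \<inter> framed a \<noteq> {} \<and> (derived (free_group n) ^^ k) E \<inter> framed b \<noteq> {}"
proof (induction k)
  case (Suc k)
  let ?D = "(derived (free_group n) ^^ k) E"
  have "subgroup ?D (free_group n)"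
    by (rule group.exp_of_derived_is_subgroup[OF group_free_group E])
  with Suc ab show ?case
    using derived_framed[of ?D n _ a _ b] derived_framed[of ?D n _ b _ a] by fastforce
qed (use assms in auto)

text \<open>The kernel condition says that \<open>f\<close> factors through the image of \<open>g\<close>, which makes the image of
  \<open>f\<close> a quotient of a subgroup of \<open>Q\<close>.  Comparing both images with the derived series of \<open>K\<close> avoids
  constructing the factorization.\<close>

lemma not_solvable_if_free_subquotient:
  assumes f: "group_hom K (free_group n) f" and g: "group_hom K Q g"
    and ker: "kernel K Q g \<subseteq> kernel K (free_group n) f"
    and "f ` carrier K \<inter> framed a \<noteq> {}" "f ` carrier K \<inter> framed b \<noteq> {}" "fst a \<noteq> fst b"
  shows "\<not> solvable Q"
proof
  interpret f: group_hom K "free_group n" f by fact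
  interpret g: group_hom K Q g by fact
  assume "solvable Q"
  then obtain k where "(derived Q ^^ k) (carrier Q) = {\<one>\<^bsub>Q\<^esub>}"
    using g.H.solvable_iff_trivial_derived_seq by blast
  then have "(derived Q ^^ k) (g ` carrier K) \<subseteq> {\<one>\<^bsub>Q\<^esub>}"
    using g.H.mono_exp_of_derived[of "g ` carrier K" "carrier Q" k] g.hom_closed by (simp add: image_subset_iff)
  then have "g ` (derived K ^^ k) (carrier K) \<subseteq> {\<one>\<^bsub>Q\<^esub>}"
    by (simp add: g.exp_of_derived_img)
  moreover have "(derived K ^^ k) (carrier K) \<subseteq> carrier K"
    by (rule f.G.exp_of_derived_in_carrier) simp
  ultimately have "(derived K ^^ k) (carrier K) \<subseteq> kernel K (free_group n) f"
    using ker by (auto simp: kernel_def)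
  then have "(derived (free_group n) ^^ k) (f ` carrier K) \<subseteq> {\<one>\<^bsub>free_group n\<^esub>}"
    by (auto simp: f.exp_of_derived_img kernel_def)
  moreover have "\<one>\<^bsub>free_group n\<^esub> \<notin> framed a"
    by (simp add: free_group_def framed_def)
  ultimately show False
    using derived_series_framed[OF f.img_is_subgroup assms(4-6), of k] by blast
qed

section \<open>Large groups\<close>

text \<open>Two powers of \<open>x\<close> lie in the same one of the finitely many cosets.\<close>

lemma (in group) finite_index_pow_mem:
  assumes "finite_index S G" and x: "x \<in> carrier G"
  obtains k :: nat where "0 < k" "x [^] k \<in> S"
proof -
  have S: "subgroup S G" and fin: "finite (rcosets S)"
    using assms by (auto simp: finite_index_def)
  let ?c = "\<lambda>i::nat. S #> x [^] i"
  have "range ?c \<subseteq> rcosets S"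
    using x by (auto simp: RCOSETS_def)
  then have "finite (range ?c)" using fin finite_subset by blast
  then have "\<not> inj ?c" using finite_imageD by blast
  then obtain i j where ij: "?c i = ?c j" "i < j"
    using linorder_injI[of ?c] by blast
  have "x [^] j \<in> S #> x [^] i"
    using repr_independenceD[OF S _ ij(1)] x by simp
  then have "x [^] j \<otimes> inv (x [^] i) \<in> S"
    using subgroup.rcos_module_imp[OF S is_group] x by simp
  moreover have "x [^] j = x [^] (j - i) \<otimes> x [^] i"
    using x ij(2) by (simp add: nat_pow_mult)
  ultimately have "x [^] (j - i) \<in> S" using x by (simp add: m_assoc)
  with ij(2) show thesis by (intro that[of "j - i"]) auto
qed

theorem proposition2p1:
  fixes G :: "('a, 'b) monoid_scheme"
  assumes "group G"
    and "finitely_generated G"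
    and "large_group G"
  shows "\<exists>N. N \<lhd> G \<and> linear_group (G Mod N) \<and> \<not> virtually_solvable (G Mod N)"
proof -
  interpret G: group G by fact
  let ?F = "free_group 2"
  obtain H f where H: "subgroup H G" and fin: "finite (rcosets\<^bsub>G\<^esub> H)"
    and f: "f \<in> epi (G\<lparr>carrier := H\<rparr>) ?F"
    using \<open>large_group G\<close> by (auto simp: large_group_def finite_index_def)
  let ?H = "G\<lparr>carrier := H\<rparr>"
  interpret f: group_hom ?H ?F f
    using f G.subgroup_imp_group[OF H] group_free_group
    by (simp add: group_hom_def group_hom_axioms_def epi_def)
  have onto: "f ` H = carrier ?F"
    using f by (simp add: epi_def)
  define \<rho> where "\<rho> = (\<lambda>x. sanov (f x))"
  have \<rho>: "matrix_rep ?H UNIV \<rho>"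
    unfolding \<rho>_def by (rule matrix_rep_hom[OF matrix_rep_sanov f.homh f.hom_one])
  obtain T where T: "finite T" "T \<subseteq> carrier G" "\<And>x. x \<in> carrier G \<Longrightarrow> \<exists>!t\<in>T. x \<otimes>\<^bsub>G\<^esub> inv\<^bsub>G\<^esub> t \<in> H"
    using G.finite_right_transversal[OF H fin] by blast
  define N where "N = rep_kernel G (T \<times> UNIV) (induced_rep G H \<rho>)"
  have rep: "matrix_rep G (T \<times> UNIV) (induced_rep G H \<rho>)"
    by (rule G.matrix_rep_induced[OF H \<rho> T])
  have N: "N \<lhd> G" and linear: "linear_group (G Mod N)"
    unfolding N_def
    by (rule matrix_rep_quotient_linear(1)[OF G.is_group rep])
       (rule matrix_rep_quotient_linear(2)[OF G.is_group rep])
  have "N \<subseteq> rep_kernel ?H UNIV \<rho>"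
    unfolding N_def by (rule G.rep_kernel_induced[OF H \<rho> T])
  also have "\<dots> \<subseteq> kernel ?H ?F f"
  proof
    fix x assume x: "x \<in> rep_kernel ?H UNIV \<rho>"
    then have "f x \<in> rep_kernel ?F UNIV sanov"
      using f.hom_closed[of x] by (simp add: rep_kernel_def \<rho>_def)
    with x show "x \<in> kernel ?H ?F f"
      by (simp add: rep_kernel_sanov kernel_def) (simp add: rep_kernel_def free_group_def)
  qed
  finally have ker: "N \<subseteq> kernel ?H ?F f" .
  interpret N: normal N G by fact
  interpret Q: group "G Mod N" by (rule N.factorgroup_is_group)
  have "\<not> solvable ((G Mod N)\<lparr>carrier := S\<rparr>)" if S: "finite_index S (G Mod N)" for S
  proof -
    have S_sub: "subgroup S (G Mod N)" using S by (simp add: finite_index_def)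
    \<comment> \<open>\<open>L\<close> is the common source of the quotient map to \<open>S\<close> and of the restriction of \<open>f\<close>.\<close>
    define L where "L = {x \<in> H. N #>\<^bsub>G\<^esub> x \<in> S}"
    interpret q: group_hom G "G Mod N" "\<lambda>x. N #>\<^bsub>G\<^esub> x"
      using N.r_coset_hom_Mod by (simp add: group_hom_def group_hom_axioms_def G.is_group Q.is_group)
    have L: "subgroup L G"
    proof (rule G.subgroupI)
      show "L \<subseteq> carrier G" using subgroup.subset[OF H] by (auto simp: L_def)
      show "L \<noteq> {}"
        using subgroup.one_closed[OF H] subgroup.one_closed[OF S_sub] q.hom_one
        by (auto simp: L_def)
    next
      fix x assume x: "x \<in> L"
      then have "x \<in> carrier G" using subgroup.subset[OF H] by (auto simp: L_def)
      then show "inv\<^bsub>G\<^esub> x \<in> L"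
        using x subgroup.m_inv_closed[OF H] subgroup.m_inv_closed[OF S_sub] q.hom_inv[of x]
        by (auto simp: L_def)
    next
      fix x y assume xy: "x \<in> L" "y \<in> L"
      then have "x \<in> carrier G" "y \<in> carrier G" using subgroup.subset[OF H] by (auto simp: L_def)
      then show "x \<otimes>\<^bsub>G\<^esub> y \<in> L"
        using xy subgroup.m_closed[OF H] subgroup.m_closed[OF S_sub] q.hom_mult[of x y]
        by (auto simp: L_def)
    qed
    let ?L = "G\<lparr>carrier := L\<rparr>"
    have L_group: "group ?L" by (rule G.subgroup_imp_group[OF L])
    have L_carr: "L \<subseteq> carrier G" by (rule subgroup.subset[OF L])
    have f_L: "group_hom ?L ?F f"
      using f.homh L_group group_free_group
      by (auto simp: group_hom_def group_hom_axioms_def hom_def L_def)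
    have q_L: "group_hom ?L ((G Mod N)\<lparr>carrier := S\<rparr>) (\<lambda>x. N #>\<^bsub>G\<^esub> x)"
      using q.homh L_group Q.subgroup_imp_group[OF S_sub] L_carr
      by (auto simp: group_hom_def group_hom_axioms_def hom_def L_def subset_iff)
    have ker_L: "kernel ?L ((G Mod N)\<lparr>carrier := S\<rparr>) (\<lambda>x. N #>\<^bsub>G\<^esub> x) \<subseteq> kernel ?L ?F f"
    proof
      fix x assume "x \<in> kernel ?L ((G Mod N)\<lparr>carrier := S\<rparr>) (\<lambda>x. N #>\<^bsub>G\<^esub> x)"
      then have "x \<in> L" "N #>\<^bsub>G\<^esub> x = N" by (auto simp: kernel_def FactGroup_def)
      then have "x \<in> N"
        using G.coset_join1[of N x] L_carr N.subgroup_axioms by blast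
      with ker \<open>x \<in> L\<close> show "x \<in> kernel ?L ?F f" by (auto simp: kernel_def)
    qed
    have framed_L: "f ` L \<inter> framed (i, True) \<noteq> {}" if "i < 2" for i
    proof -
      have "[(i, True)] \<in> carrier ?F"
        using that by (simp add: free_group_def reduced_def)
      with onto obtain x where x: "x \<in> H" "f x = [(i, True)]" by (metis imageE)
      have x_carr: "x \<in> carrier G" using x subgroup.subset[OF H] by blast
      have "N #>\<^bsub>G\<^esub> x \<in> carrier (G Mod N)" using q.hom_closed[OF x_carr] .
      then obtain k :: nat where k: "0 < k" "(N #>\<^bsub>G\<^esub> x) [^]\<^bsub>G Mod N\<^esub> k \<in> S"
        using Q.finite_index_pow_mem[OF S] by blast
      then have "N #>\<^bsub>G\<^esub> (x [^]\<^bsub>G\<^esub> k) \<in> S"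
        by (simp add: N.FactGroup_pow[OF x_carr])
      moreover have pow: "x [^]\<^bsub>?H\<^esub> k = x [^]\<^bsub>G\<^esub> k"
        by (simp add: G.nat_pow_consistent[symmetric])
      ultimately have "x [^]\<^bsub>?H\<^esub> k \<in> L"
        using f.G.nat_pow_closed[of x k] x(1) by (simp add: L_def)
      moreover have "f (x [^]\<^bsub>?H\<^esub> k) \<in> framed (i, True)"
        using f.hom_nat_pow[of x k] x k(1) pow_framed[of "[(i, True)]" "(i, True)" k 2]
        by (simp add: framed_def reduced_def)
      ultimately show ?thesis by blast
    qed
    show ?thesis
      using not_solvable_if_free_subquotient[OF f_L q_L ker_L, of "(0, True)" "(1, True)"]
        framed_L[of 0] framed_L[of 1] by simp
  qed
  then have "\<not> virtually_solvable (G Mod N)"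
    by (auto simp: virtually_solvable_def)
  with N linear show ?thesis by blast
qed

end
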